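(* Let $H$ be a Hilbert space, let $A$ be the generator of a $C_0$-semigroup $(S(t))_{t\ge 0}$ on $H$ and let $M,\omega>0$ be constants with $\|S(t)\|\le Me^{-\omega t}$ for all $t\ge 0$. Let $B:H\to H$ be a continuous linear operator. Let $\bar\tau>0$, let $\tau:[0,+\infty)\to(0,+\infty)$ be a continuous function with $0\le\tau(t)\le\bar\tau$ for all $t\ge 0$, and let $k\in L^1_{loc}([-\bar\tau,+\infty);\mathbb{R})$ satisfy, for some $K>0$, $\int_{t-\bar\tau}^t|k(s)|\,ds\le K$ for all $t\ge 0$. Let $G:H\to H$ satisfy $G(0)=0$ and, for some $L>0$, $\|G(U_1)-G(U_2)\|\le L\|U_1-U_2\|$ for all $U_1,U_2\in H$. Assume that there are constants $\gamma\ge 0$ and $\omega'\in[0,\omega)$ such that $$M\|B\|e^{\omega\bar\tau}\int_0^t|k(s)|\,ds\le\gamma+\omega' t\qquad\text{for all } t\ge 0,$$ and that $L<\frac{\omega-\omega'}{M}$. Then for every $f\in C([-\bar\tau,0];H)$, with $U_0:=f(0)$, the solution $U\in C([0,+\infty);H)$ of $$U'(t)=AU(t)+k(t)BU(t-\tau(t))+G(U(t)),\quad t\in(0,\infty),\qquad U(t)=f(t),\quad t\in[-\bar\tau,0],$$ satisfies $$\|U(t)\|\le Me^{\gamma}\Big(\|U_0\|+e^{\omega\bar\tau}K\|B\|\max_{s\in[-\bar\tau,0]}\|e^{\omega s}f(s)\|\Big)e^{-(\omega-\omega'-ML)t}\qquad\text{for all } t\ge 0.$$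
   Context: The solution of the problem with initial datum $f$ is understood in the weak (mild) sense: it is the continuous function $U:[-\bar\tau,+\infty)\to H$ with $U=f$ on $[-\bar\tau,0]$ and $$U(t)=S(t)U_0+\int_0^tS(t-s)\big[G(U(s))+k(s)BU(s-\tau(s))\big]\,ds\qquad\text{for all } t\ge 0.$$ *)

theory Defs
  imports "HOL-Analysis.Analysis"
begin

definition C0_semigroup :: "(real \<Rightarrow> 'a::real_normed_vector \<Rightarrow>\<^sub>L 'a) \<Rightarrow> bool" where
  "C0_semigroup S \<longleftrightarrow>
     S 0 = id_blinfun \<and>
     (\<forall>s\<ge>0. \<forall>t\<ge>0. S (s + t) = S s o\<^sub>L S t) \<and>
     (\<forall>x. ((\<lambda>t. blinfun_apply (S t) x) \<longlongrightarrow> x) (at_right 0))"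

text \<open>The infinitesimal generator is unbounded in general; it is represented by its graph, whose
  first projection is its domain.\<close>

definition generator :: "(real \<Rightarrow> 'a::real_normed_vector \<Rightarrow>\<^sub>L 'a) \<Rightarrow> ('a \<times> 'a) set" where
  "generator S = {(x, y). ((\<lambda>h. (blinfun_apply (S h) x - x) /\<^sub>R h) \<longlongrightarrow> y) (at_right 0)}"

text \<open>Solutions of \<open>U'(t) = A U(t) + k(t) B U(t - \<tau>(t)) + G(U(t))\<close> for \<open>t > 0\<close> with \<open>U = f\<close> on
  \<open>[-r, 0]\<close>, in the mild sense, where \<open>S\<close> is the semigroup generated by \<open>A\<close>.
  The vector-valued integral is the Henstock-Kurzweil one, because the library's Bochner
  integral requires a second-countable (separable) space. When \<open>\<tau>\<close> and \<open>G\<close> are continuous and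
  \<open>k\<close> is locally integrable, the integrand is Bochner integrable for every continuous \<open>U\<close>, and
  both integrals coincide.\<close>

definition mild_solution ::
  "(real \<Rightarrow> 'a::banach \<Rightarrow>\<^sub>L 'a) \<Rightarrow> ('a \<Rightarrow>\<^sub>L 'a) \<Rightarrow> (real \<Rightarrow> real) \<Rightarrow> (real \<Rightarrow> real) \<Rightarrow> ('a \<Rightarrow> 'a) \<Rightarrow>
     real \<Rightarrow> (real \<Rightarrow> 'a) \<Rightarrow> (real \<Rightarrow> 'a) \<Rightarrow> bool" where
  "mild_solution S B k \<tau> G r f U \<longleftrightarrow>
     continuous_on {-r..} U \<and>
     (\<forall>t\<in>{-r..0}. U t = f t) \<and>
     (\<forall>t\<ge>0.
        (\<lambda>s. blinfun_apply (S (t - s)) (G (U s) + k s *\<^sub>R blinfun_apply B (U (s - \<tau> s))))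
          integrable_on {0..t} \<and>
        U t = blinfun_apply (S t) (f 0) +
          integral {0..t}
            (\<lambda>s. blinfun_apply (S (t - s)) (G (U s) + k s *\<^sub>R blinfun_apply B (U (s - \<tau> s)))))"

end

theory Submission imports Defs begin

text \<open>With \<open>v t = e\<^bsup>\<omega>t\<^esup> \<parallel>U t\<parallel>\<close> and \<open>b = M \<parallel>B\<parallel> e\<^bsup>\<omega>\<tau>\<^esup>\<close>, the variation of constants
  formula gives \<open>v t \<le> D + \<integral> (M L v s + b \<bar>k s\<bar> v (s - \<tau> s)) ds\<close>, where the part of the delay
  term that sees the initial datum (only for \<open>s\<close> up to the maximal delay) is absorbed in the
  constant \<open>D\<close>. If \<open>v\<close> lies below a multiple of \<open>e\<^bsup>E\<^esup>\<close> up to time \<open>s\<close>, where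
  \<open>E t = \<integral> (M L + b \<bar>k\<bar>)\<close> is nondecreasing, then so does the delayed value. Hence
  \<open>v \<le> D e\<^bsup>E\<^esup>\<close> follows by looking at a first crossing time, and \<open>E t \<le> M L t + \<gamma> + \<omega>' t\<close>.\<close>

text \<open>Gauge integrability alone does not survive multiplication by a continuous function.
  Nonnegativity makes \<open>a\<close> absolutely integrable, and then a bounded measurable factor
  does no harm.\<close>

lemma integrable_mult_continuous_real:
  fixes a g :: "real \<Rightarrow> real"
  assumes "a integrable_on {c..d}" "\<And>s. s \<in> {c..d} \<Longrightarrow> 0 \<le> a s" "continuous_on {c..d} g"
  shows "(\<lambda>s. a s * g s) integrable_on {c..d}"
proof -
  have "(\<lambda>s. g s * a s) absolutely_integrable_on {c..d}"
    using assms
    by (intro absolutely_integrable_bounded_measurable_product_real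
        nonnegative_absolutely_integrable_1 compact_imp_bounded compact_continuous_image
        continuous_imp_measurable_on_sets_lebesgue) auto
  then show ?thesis
    by (simp add: absolutely_integrable_on_def mult.commute)
qed

lemma integral_diff_real:
  fixes a :: "real \<Rightarrow> real"
  assumes "a integrable_on {c..T}" "c \<le> s" "s \<le> t" "t \<le> T"
  shows "integral {s..t} a = integral {c..t} a - integral {c..s} a"
proof -
  have "a integrable_on {c..t}"
    using assms by (auto intro: integrable_subinterval_real)
  then show ?thesis
    using Henstock_Kurzweil_Integration.integral_combine[of c s t a] assms by simp
qed

lemma integral_mono_upper_real:
  fixes a :: "real \<Rightarrow> real"
  assumes "a integrable_on {c..t}" "\<And>s. s \<in> {c..t} \<Longrightarrow> 0 \<le> a s" "s \<le> t"
  shows "integral {c..s} a \<le> integral {c..t} a"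
  using assms by (intro integral_subset_le) (auto intro: integrable_subinterval_real)

text \<open>The chain rule is not available for merely integrable \<open>a\<close>. On an interval where the
  primitive \<open>E\<close> varies by less than \<open>\<delta>\<close>, the integral of \<open>a e\<^bsup>E\<^esup>\<close> exceeds the increment of
  \<open>e\<^bsup>E\<^esup>\<close> at most by the factor \<open>e\<^bsup>\<delta>\<^esup>\<close>.\<close>
lemma integral_mult_exp_integral_le:
  fixes a :: "real \<Rightarrow> real"
  assumes "c \<le> T" and a: "a integrable_on {c..T}"
    and nonneg: "\<And>s. s \<in> {c..T} \<Longrightarrow> 0 \<le> a s"
  defines "E \<equiv> \<lambda>t. integral {c..t} a"
  shows "integral {c..T} (\<lambda>s. a s * exp (E s)) \<le> exp (E T) - 1"
proof -
  have contE: "continuous_on {c..T} E"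
    unfolding E_def using a by (rule indefinite_integral_continuous_1)
  have int: "(\<lambda>s. a s * exp (E s)) integrable_on {c..T}"
    by (intro integrable_mult_continuous_real a nonneg continuous_intros contE)
  have mono: "E s \<le> E t" if "s \<le> t" "t \<le> T" for s t
    unfolding E_def using that nonneg a
    by (intro integral_mono_upper_real) (auto intro: integrable_subinterval_real)
  have approx: "integral {c..T} (\<lambda>s. a s * exp (E s)) \<le> exp \<delta> * (exp (E T) - 1)"
    if "\<delta> > 0" for \<delta>
  proof -
    \<comment> \<open>Bolzano's bisection principle reduces the estimate to short intervals, since
      its right-hand side telescopes. Short intervals around a point near an end of
      \<open>{c..T}\<close> may stick out, so \<open>P\<close> speaks only of those inside.\<close>
    define P where "P p q \<longleftrightarrow> (c \<le> p \<and> q \<le> T \<longrightarrow>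
        integral {p..q} (\<lambda>s. a s * exp (E s)) \<le> exp \<delta> * (exp (E q) - exp (E p)))" for p q
    have "P c T"
      using \<open>c \<le> T\<close>
    proof (induction rule: Bolzano)
      case (trans p q r)
      show ?case
        unfolding P_def
      proof (intro impI, elim conjE)
        assume pr: "c \<le> p" "r \<le> T"
        have "integral {p..r} (\<lambda>s. a s * exp (E s)) =
            integral {p..q} (\<lambda>s. a s * exp (E s)) + integral {q..r} (\<lambda>s. a s * exp (E s))"
          using trans pr
          by (intro Henstock_Kurzweil_Integration.integral_combine[symmetric]
              integrable_subinterval_real[OF int]) auto
        also have "\<dots> \<le> exp \<delta> * (exp (E q) - exp (E p)) + exp \<delta> * (exp (E r) - exp (E q))"
          using trans pr unfolding P_def by (intro add_mono) auto
        finally show "integral {p..r} (\<lambda>s. a s * exp (E s)) \<le> exp \<delta> * (exp (E r) - exp (E p))"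
          by (simp add: algebra_simps)
      qed
    next
      case (local x)
      have "\<delta> / 2 > 0" "x \<in> {c..T}"
        using \<open>\<delta> > 0\<close> local by auto
      then obtain d where d: "d > 0" "\<And>y. y \<in> {c..T} \<Longrightarrow> dist y x < d \<Longrightarrow> dist (E y) (E x) < \<delta> / 2"
        using contE unfolding continuous_on_iff by metis
      have "integral {p..q} (\<lambda>s. a s * exp (E s)) \<le> exp \<delta> * (exp (E q) - exp (E p))"
        if pq: "p \<le> x" "x \<le> q" "q - p < d" "c \<le> p" "q \<le> T" for p q
      proof -
        have "dist (E p) (E x) < \<delta> / 2" "dist (E q) (E x) < \<delta> / 2"
          using pq by (intro d(2); simp add: dist_real_def)+
        then have close: "E q \<le> \<delta> + E p"
          unfolding dist_real_def by linarith
        \<comment> \<open>Freezing the exponential at the right end, where it is largest, leaves a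
          constant times the increment of \<open>E\<close>.\<close>
        have "integral {p..q} (\<lambda>s. a s * exp (E s)) \<le> integral {p..q} (\<lambda>s. a s * exp (E q))"
          using pq nonneg mono a
          by (intro integral_le integrable_subinterval_real[OF int] integrable_on_mult_left
              mult_left_mono) (auto intro: integrable_subinterval_real)
        also have "\<dots> = exp (E q) * (E q - E p)"
          unfolding E_def using integral_diff_real[OF a, of p q] pq by simp
        \<comment> \<open>Going back from \<open>exp (E q)\<close> to \<open>exp (E p)\<close> costs
          the factor \<open>exp \<delta>\<close>; the inequality \<open>x \<le> exp x - 1\<close>
          then turns the increment of \<open>E\<close> into one of the exponential.\<close>
        also have "\<dots> \<le> (exp \<delta> * exp (E p)) * (exp (E q - E p) - 1)"
        proof (rule mult_mono)
          show "E q - E p \<le> exp (E q - E p) - 1"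
            using exp_ge_add_one_self[of "E q - E p"] by linarith
        qed (use mono[of p q] pq close in \<open>auto simp flip: exp_add\<close>)
        also have "\<dots> = exp \<delta> * (exp (E q) - exp (E p))"
          by (simp add: algebra_simps exp_diff)
        finally show ?thesis .
      qed
      then show ?case
        using d(1) unfolding P_def by blast
    qed
    then show ?thesis
      by (simp add: P_def E_def)
  qed
  have "((\<lambda>\<delta>. exp \<delta> * (exp (E T) - 1)) \<longlongrightarrow> exp 0 * (exp (E T) - 1)) (at_right 0)"
    by (intro tendsto_intros)
  moreover have "\<forall>\<^sub>F \<delta> in at_right 0.
      integral {c..T} (\<lambda>s. a s * exp (E s)) \<le> exp \<delta> * (exp (E T) - 1)"
    using eventually_at_right_less[of 0] by (rule eventually_mono) (rule approx)
  ultimately show ?thesis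
    using tendsto_lowerbound[OF _ _ trivial_limit_at_right_real] by simp
qed

text \<open>The integral inequality may be derived under the bound that is to be proved for the past;
  this is what lets delayed arguments enter.\<close>
lemma gronwall_first_crossing:
  fixes v a :: "real \<Rightarrow> real"
  assumes contv: "continuous_on {0..} v"
    and a: "\<And>t. a integrable_on {0..t}"
    and nonneg: "\<And>s. 0 \<le> s \<Longrightarrow> 0 \<le> a s"
    and "v 0 \<le> D" "0 \<le> D"
  defines "E \<equiv> \<lambda>t. integral {0..t} a"
  assumes step: "\<And>t D'. 0 < t \<Longrightarrow> D < D' \<Longrightarrow> \<forall>s\<in>{0..t}. v s \<le> D' * exp (E s) \<Longrightarrow>
      v t \<le> D + D' * integral {0..t} (\<lambda>s. a s * exp (E s))"
    and "0 \<le> t"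
  shows "v t \<le> D * exp (E t)"
proof -
  \<comment> \<open>The slack \<open>D < D'\<close> makes the inequality strict at time
    \<open>0\<close>, where \<open>E\<close> vanishes, so a violation forces a first zero of
    \<open>h\<close>. Letting \<open>D'\<close> decrease to \<open>D\<close> removes the slack
    afterwards.\<close>
  have bound: "v t < D' * exp (E t)" if "D < D'" "0 \<le> t" for D' t
  proof (rule ccontr)
    assume neg: "\<not> v t < D' * exp (E t)"
    define h where "h s = v s - D' * exp (E s)" for s
    have conth: "continuous_on {0..u} h" for u
      unfolding h_def E_def
      by (intro continuous_intros continuous_on_subset[OF contv]
          indefinite_integral_continuous_1 a) auto
    have h0: "h 0 < 0"
      using assms that by (simp add: h_def E_def)
    define Z where "Z = {0..t} \<inter> h -` {0}"
    have "0 \<le> h t"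
      using neg by (simp add: h_def)
    then obtain z where "0 \<le> z" "z \<le> t" "h z = 0"
      using IVT'[of h 0 0 t] h0 conth \<open>0 \<le> t\<close> by auto
    then have "z \<in> Z"
      by (simp add: Z_def)
    have "closed Z"
      unfolding Z_def by (intro continuous_closed_preimage conth) auto
    moreover have "Z \<noteq> {}"
      using \<open>z \<in> Z\<close> by auto
    moreover have "bdd_below Z"
      by (auto simp: Z_def)
    ultimately have "Inf Z \<in> Z"
      by (intro closed_contains_Inf)
    define u where "u = Inf Z"
    have u: "0 \<le> u" "u \<le> t" "h u = 0"
      using \<open>Inf Z \<in> Z\<close> by (auto simp: Z_def u_def)
    have "u \<noteq> 0"
      using h0 u by auto
    \<comment> \<open>By the intermediate value theorem, a positive value here would produce a zero
      of \<open>h\<close> strictly earlier than the least one, \<open>u\<close>.\<close>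
    have "h s \<le> 0" if "s \<in> {0..u}" for s
    proof (rule ccontr)
      assume "\<not> h s \<le> 0"
      moreover have "0 \<le> s"
        using that by simp
      ultimately obtain x where x: "0 \<le> x" "x \<le> s" "h x = 0"
        using IVT'[of h 0 0 s] h0 conth[of s] by auto
      then have "x \<in> Z"
        using that u by (auto simp: Z_def)
      then have "u \<le> x"
        unfolding u_def by (intro cInf_lower) (auto simp: Z_def)
      then have "x = s"
        using x that by auto
      then show False
        using x \<open>\<not> h s \<le> 0\<close> by simp
    qed
    then have "\<forall>s\<in>{0..u}. v s \<le> D' * exp (E s)"
      by (simp add: h_def)
    then have "v u \<le> D + D' * integral {0..u} (\<lambda>s. a s * exp (E s))"
      using u \<open>u \<noteq> 0\<close> that by (intro step) auto
    also have "\<dots> \<le> D + D' * (exp (E u) - 1)"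
      unfolding E_def using u that \<open>0 \<le> D\<close> a nonneg
      by (intro add_left_mono mult_left_mono integral_mult_exp_integral_le) auto
    \<comment> \<open>The left side is \<open>D' * exp (E u)\<close> minus the slack
      \<open>D' - D\<close>, whereas \<open>h u = 0\<close> demands equality.\<close>
    also have "\<dots> < D' * exp (E u)"
      using that by (simp add: algebra_simps)
    finally show False
      using u by (simp add: h_def)
  qed
  have "v t / exp (E t) \<le> D"
  proof (rule dense_ge)
    fix D' assume "D < D'"
    then show "v t / exp (E t) \<le> D'"
      using bound[of D' t] \<open>0 \<le> t\<close> by (simp add: pos_divide_le_eq)
  qed
  then show ?thesis
    by (simp add: pos_divide_le_eq)
qed

theorem theorem4p2:
  fixes S :: "real \<Rightarrow> 'h::{real_inner, banach} \<Rightarrow>\<^sub>L 'h"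
    and A :: "('h \<times> 'h) set"
    and B :: "'h \<Rightarrow>\<^sub>L 'h"
    and G :: "'h \<Rightarrow> 'h"
    and k \<tau> :: "real \<Rightarrow> real"
    and M \<omega> \<omega>' \<tau>bar K L \<gamma> :: real
  assumes "C0_semigroup S" and "A = generator S"
    and "M > 0" and "\<omega> > 0"
    and "\<And>t. t \<ge> 0 \<Longrightarrow> norm (S t) \<le> M * exp (- \<omega> * t)"
    and "\<tau>bar > 0"
    and "continuous_on {0..} \<tau>"
    and "\<And>t. t \<ge> 0 \<Longrightarrow> 0 < \<tau> t \<and> \<tau> t \<le> \<tau>bar"
    and "\<And>b. k absolutely_integrable_on {-\<tau>bar..b}"
    and "K > 0"
    and "\<And>t. t \<ge> 0 \<Longrightarrow> integral {t - \<tau>bar..t} (\<lambda>s. \<bar>k s\<bar>) \<le> K"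
    and "G 0 = 0"
    and "L > 0"
    and "\<And>x y. norm (G x - G y) \<le> L * norm (x - y)"
    and "\<gamma> \<ge> 0"
    and "0 \<le> \<omega>'" and "\<omega>' < \<omega>"
    and "\<And>t. t \<ge> 0 \<Longrightarrow>
           M * norm B * exp (\<omega> * \<tau>bar) * integral {0..t} (\<lambda>s. \<bar>k s\<bar>) \<le> \<gamma> + \<omega>' * t"
    and "L < (\<omega> - \<omega>') / M"
  shows "\<forall>f U. continuous_on {-\<tau>bar..0} f \<longrightarrow> mild_solution S B k \<tau> G \<tau>bar f U \<longrightarrow>
           (\<forall>t\<ge>0. norm (U t) \<le>
              M * exp \<gamma> *
              (norm (f 0) + exp (\<omega> * \<tau>bar) * K * norm B *
                 (SUP s\<in>{-\<tau>bar..0}. norm (exp (\<omega> * s) *\<^sub>R f s))) *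
              exp (- (\<omega> - \<omega>' - M * L) * t))"
proof (intro allI impI)
  fix f U t
  assume contf: "continuous_on {-\<tau>bar..0} f" and mild: "mild_solution S B k \<tau> G \<tau>bar f U"
    and "0 \<le> (t::real)"

  \<comment> \<open>Constants, weights and integrability\<close>
  note M = assms(3) and \<omega> = assms(4) and normS = assms(5) and \<tau>bar = assms(6) and \<tau> = assms(8)
    and L = assms(13)
  have contU: "continuous_on {-\<tau>bar..} U" and Uf: "\<And>s. s \<in> {-\<tau>bar..0} \<Longrightarrow> U s = f s"
    using mild by (auto simp: mild_solution_def)
  define F where "F s = G (U s) + k s *\<^sub>R blinfun_apply B (U (s - \<tau> s))" for s
  have Fint: "(\<lambda>s. blinfun_apply (S (t - s)) (F s)) integrable_on {0..t}"
    and Ueq: "U t = blinfun_apply (S t) (f 0) + integral {0..t} (\<lambda>s. blinfun_apply (S (t - s)) (F s))"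
    if "0 \<le> t" for t
    using mild that unfolding mild_solution_def F_def by blast+
  have kint: "(\<lambda>s. \<bar>k s\<bar>) integrable_on {c..u}" if "-\<tau>bar \<le> c" for c u
    using assms(9)[of u] that
    by (auto simp: absolutely_integrable_on_def intro: integrable_subinterval_real)
  \<comment> \<open>The factor \<open>exp (\<omega> * \<tau>bar)\<close> pays for comparing the
    weight at time \<open>s\<close> with the weight at the delayed time.\<close>
  define b where "b = M * norm B * exp (\<omega> * \<tau>bar)"
  define C where "C = (SUP s\<in>{-\<tau>bar..0}. norm (exp (\<omega> * s) *\<^sub>R f s))"
  \<comment> \<open>\<open>C\<close> bounds the weighted initial datum and \<open>K\<close> the mass
    of \<open>\<bar>k s\<bar>\<close> over one delay length; \<open>D\<close> is \<open>M\<close>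
    times the bracket in the claim.\<close>
  define D where "D = M * norm (f 0) + b * K * C"
  define a where "a s = M * L + b * \<bar>k s\<bar>" for s
  define E where "E u = integral {0..u} a" for u
  define v where "v s = exp (\<omega> * s) * norm (U s)" for s
  have "b \<ge> 0"
    using M by (simp add: b_def)
  have "bdd_above ((\<lambda>s. norm (exp (\<omega> * s) *\<^sub>R f s)) ` {-\<tau>bar..0})"
    by (intro bounded_imp_bdd_above compact_imp_bounded compact_continuous_image
        continuous_intros contf) auto
  then have C: "exp (\<omega> * s) * norm (f s) \<le> C" if "s \<in> {-\<tau>bar..0}" for s
    unfolding C_def using cSUP_upper[OF that] by fastforce
  have "0 \<le> norm (f 0)"
    by simp
  also have "norm (f 0) \<le> C"
    using C[of 0] \<tau>bar by simp
  finally have "C \<ge> 0" .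
  have aint: "a integrable_on {0..u}" for u
    unfolding a_def using \<tau>bar by (intro integrable_add integrable_on_mult_right kint) auto
  have anonneg: "0 \<le> a s" for s
    using M L \<open>b \<ge> 0\<close> by (simp add: a_def)
  have Emono: "E s \<le> E u" if "s \<le> u" for s u
    unfolding E_def using that aint anonneg by (intro integral_mono_upper_real) auto
  have aEint: "(\<lambda>s. a s * exp (E s)) integrable_on {0..u}" for u
    unfolding E_def
    by (intro integrable_mult_continuous_real aint anonneg continuous_intros
        indefinite_integral_continuous_1)
  \<comment> \<open>A negative delayed time needs \<open>s < \<tau> s \<le> \<tau>bar\<close>, so
    the initial datum is seen only up to \<open>\<tau>bar\<close>. The cut-off \<open>q\<close> has
    integral at most \<open>K\<close> however large \<open>u\<close> is, because
    \<open>{0..\<tau>bar}\<close> is one window of the hypothesis on \<open>k\<close>.\<close>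
  define q where "q s = (if s \<in> {..\<tau>bar} then \<bar>k s\<bar> else 0)" for s
  have Int: "{..\<tau>bar} \<inter> {0..u} = {0..min u \<tau>bar}" for u
    by auto
  have qint: "q integrable_on {0..u}" for u
    unfolding q_def[abs_def] integrable_restrict_Int Int
    using \<tau>bar by (intro kint) auto
  have qle: "integral {0..u} q \<le> K" for u
  proof -
    have "integral {0..u} q = integral {0..min u \<tau>bar} (\<lambda>s. \<bar>k s\<bar>)"
      unfolding q_def[abs_def] integral_restrict_Int Int ..
    also have "\<dots> \<le> integral {0..\<tau>bar} (\<lambda>s. \<bar>k s\<bar>)"
      using \<tau>bar by (intro integral_mono_upper_real kint) auto
    also have "\<dots> \<le> K"
      using assms(11)[of \<tau>bar] \<tau>bar by simp
    finally show ?thesis .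
  qed

  \<comment> \<open>The Gronwall estimate for the weighted norm\<close>
  have "v t \<le> D * exp (E t)"
    unfolding E_def
  proof (rule gronwall_first_crossing; (fold E_def)?)
    show "continuous_on {0..} v"
      unfolding v_def using \<tau>bar by (intro continuous_intros continuous_on_subset[OF contU]) auto
    show "0 \<le> D"
      using M \<open>b \<ge> 0\<close> \<open>C \<ge> 0\<close> \<open>K > 0\<close> by (simp add: D_def)
    have "norm (U 0) \<le> norm (S 0) * norm (f 0)"
      using Ueq[of 0] by (simp add: norm_blinfun)
    also have "\<dots> \<le> M * norm (f 0)"
      using normS[of 0] by (intro mult_right_mono) auto
    also have "\<dots> \<le> D"
      using \<open>b \<ge> 0\<close> \<open>C \<ge> 0\<close> \<open>K > 0\<close> by (simp add: D_def)
    finally show "v 0 \<le> D"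
      by (simp add: v_def)
  next
    fix u D'
    assume u: "0 < u" and "D < D'" and past: "\<forall>s\<in>{0..u}. v s \<le> D' * exp (E s)"
    have "0 \<le> D"
      using M \<open>b \<ge> 0\<close> \<open>C \<ge> 0\<close> \<open>K > 0\<close> by (simp add: D_def)
    then have "D' \<ge> 0"
      using \<open>D < D'\<close> by simp
    \<comment> \<open>Majorant of the integrand's norm: the term with \<open>D'\<close> accounts for
      the solution at nonnegative times, the term with \<open>q\<close> for the initial
      datum.\<close>
    define g where "g s = exp (- \<omega> * u) * (D' * (a s * exp (E s)) + b * C * q s)" for s
    have gint: "g integrable_on {0..u}"
      unfolding g_def by (intro integrable_on_mult_right integrable_add aEint qint)
    have ptw: "norm (blinfun_apply (S (u - s)) (F s)) \<le> g s" if s: "s \<in> {0..u}" for s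
    proof -
      have delayed: "\<bar>k s\<bar> * (exp (\<omega> * s) * norm (U (s - \<tau> s))) \<le>
          exp (\<omega> * \<tau>bar) * (D' * (\<bar>k s\<bar> * exp (E s)) + C * q s)"
      proof -
        have "\<bar>k s\<bar> * v (s - \<tau> s) \<le> D' * (\<bar>k s\<bar> * exp (E s)) + C * q s"
        \<comment> \<open>A nonnegative delayed time is covered by the bound on the past and the
          monotonicity of \<open>E\<close>, a negative one by \<open>C\<close>, with
          \<open>q s\<close> equal to \<open>\<bar>k s\<bar>\<close>. Each case adds the other's
          nonnegative term.\<close>
        proof (cases "0 \<le> s - \<tau> s")
          case True
          then have "v (s - \<tau> s) \<le> D' * exp (E (s - \<tau> s))"
            using past s \<tau>[of s] by auto
          also have "\<dots> \<le> D' * exp (E s)"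
            using \<open>D' \<ge> 0\<close> Emono[of "s - \<tau> s" s] \<tau>[of s] s by (intro mult_left_mono) auto
          finally have "\<bar>k s\<bar> * v (s - \<tau> s) \<le> \<bar>k s\<bar> * (D' * exp (E s))"
            by (intro mult_left_mono) auto
          also have "\<dots> \<le> \<bar>k s\<bar> * (D' * exp (E s)) + C * q s"
            using \<open>C \<ge> 0\<close> by (simp add: q_def)
          finally show ?thesis
            by (simp add: mult_ac)
        next
          case False
          then have r: "s - \<tau> s \<in> {-\<tau>bar..0}" "q s = \<bar>k s\<bar>"
            using \<tau>[of s] s by (auto simp: q_def)
          then have "\<bar>k s\<bar> * v (s - \<tau> s) \<le> \<bar>k s\<bar> * C"
            using C[OF r(1)] Uf[OF r(1)] by (intro mult_left_mono) (auto simp: v_def)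
          also have "\<dots> \<le> D' * (\<bar>k s\<bar> * exp (E s)) + \<bar>k s\<bar> * C"
            using \<open>D' \<ge> 0\<close> by simp
          finally show ?thesis
            by (simp add: r(2) mult_ac)
        qed
        then have "exp (\<omega> * \<tau>bar) * (\<bar>k s\<bar> * v (s - \<tau> s)) \<le>
            exp (\<omega> * \<tau>bar) * (D' * (\<bar>k s\<bar> * exp (E s)) + C * q s)"
          by (intro mult_left_mono) auto
        moreover have "exp (\<omega> * s) \<le> exp (\<omega> * \<tau>bar) * exp (\<omega> * (s - \<tau> s))"
          using \<omega> \<tau>[of s] s by (simp flip: exp_add distrib_left)
        then have "\<bar>k s\<bar> * (exp (\<omega> * s) * norm (U (s - \<tau> s))) \<le>
            \<bar>k s\<bar> * ((exp (\<omega> * \<tau>bar) * exp (\<omega> * (s - \<tau> s))) * norm (U (s - \<tau> s)))"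
          by (intro mult_left_mono mult_right_mono) auto
        then have "\<bar>k s\<bar> * (exp (\<omega> * s) * norm (U (s - \<tau> s))) \<le>
            exp (\<omega> * \<tau>bar) * (\<bar>k s\<bar> * v (s - \<tau> s))"
          by (simp only: v_def mult_ac)
        ultimately show ?thesis
          by linarith
      qed
      have "norm (G (U s)) \<le> L * norm (U s)"
        using assms(14)[of "U s" 0] assms(12) by simp
      moreover have "norm (k s *\<^sub>R blinfun_apply B (U (s - \<tau> s))) \<le>
          \<bar>k s\<bar> * (norm B * norm (U (s - \<tau> s)))"
        by (simp add: mult_left_mono norm_blinfun)
      ultimately have F: "norm (F s) \<le> L * norm (U s) + \<bar>k s\<bar> * (norm B * norm (U (s - \<tau> s)))"
        unfolding F_def by (intro norm_triangle_le) linarith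
      have "norm (blinfun_apply (S (u - s)) (F s)) \<le> norm (S (u - s)) * norm (F s)"
        by (rule norm_blinfun)
      also have "\<dots> \<le> (M * exp (- \<omega> * (u - s))) *
          (L * norm (U s) + \<bar>k s\<bar> * (norm B * norm (U (s - \<tau> s))))"
        using normS[of "u - s"] s M F by (intro mult_mono) auto
      \<comment> \<open>Splitting the decay into \<open>exp (- \<omega> * u)\<close> and
        \<open>exp (\<omega> * s)\<close> attaches the weight to the solution; the first factor
        leaves the integral.\<close>
      also have "\<dots> = exp (- \<omega> * u) * (M * L * v s +
          M * norm B * (\<bar>k s\<bar> * (exp (\<omega> * s) * norm (U (s - \<tau> s)))))"
      proof -
        have "exp (- \<omega> * (u - s)) = exp (- \<omega> * u) * exp (\<omega> * s)"
          by (simp add: algebra_simps flip: exp_add)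
        then show ?thesis
          by (simp add: v_def algebra_simps)
      qed
      also have "\<dots> \<le> exp (- \<omega> * u) * (M * L * (D' * exp (E s)) +
          M * norm B * (exp (\<omega> * \<tau>bar) * (D' * (\<bar>k s\<bar> * exp (E s)) + C * q s)))"
        using past s M L delayed by (intro mult_left_mono add_mono) auto
      also have "\<dots> = g s"
        by (simp add: g_def a_def b_def algebra_simps)
      finally show ?thesis .
    qed
    have "norm (U u) \<le> norm (blinfun_apply (S u) (f 0)) +
        norm (integral {0..u} (\<lambda>s. blinfun_apply (S (u - s)) (F s)))"
      using Ueq[of u] u by (simp add: norm_triangle_ineq)
    also have "\<dots> \<le> M * exp (- \<omega> * u) * norm (f 0) + integral {0..u} g"
    proof (rule add_mono)
      have "norm (blinfun_apply (S u) (f 0)) \<le> norm (S u) * norm (f 0)"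
        by (rule norm_blinfun)
      also have "\<dots> \<le> M * exp (- \<omega> * u) * norm (f 0)"
        using normS[of u] u by (intro mult_right_mono) auto
      finally show "norm (blinfun_apply (S u) (f 0)) \<le> M * exp (- \<omega> * u) * norm (f 0)" .
      show "norm (integral {0..u} (\<lambda>s. blinfun_apply (S (u - s)) (F s))) \<le> integral {0..u} g"
        using u ptw
        by (intro Henstock_Kurzweil_Integration.integral_norm_bound_integral Fint gint) auto
    qed
    also have "integral {0..u} g = exp (- \<omega> * u) *
        (D' * integral {0..u} (\<lambda>s. a s * exp (E s)) + b * C * integral {0..u} q)"
      unfolding g_def
      by (simp add: Henstock_Kurzweil_Integration.integral_add integrable_on_mult_right aEint qint)
    \<comment> \<open>The weight at time \<open>u\<close> cancels the common decay factor; bounding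
      the integral of \<open>q\<close> by \<open>K\<close> then completes the constant
      \<open>D\<close>.\<close>
    finally have "exp (\<omega> * u) * norm (U u) \<le> exp (\<omega> * u) * (M * exp (- \<omega> * u) * norm (f 0) +
        exp (- \<omega> * u) * (D' * integral {0..u} (\<lambda>s. a s * exp (E s)) + b * C * integral {0..u} q))"
      by (intro mult_left_mono) auto
    also have "\<dots> = M * norm (f 0) +
        (D' * integral {0..u} (\<lambda>s. a s * exp (E s)) + b * C * integral {0..u} q)"
      by (simp add: exp_minus field_simps)
    also have "b * C * integral {0..u} q \<le> b * C * K"
      using \<open>b \<ge> 0\<close> \<open>C \<ge> 0\<close> qle by (intro mult_left_mono) auto
    finally show "v u \<le> D + D' * integral {0..u} (\<lambda>s. a s * exp (E s))"
      by (simp add: v_def D_def mult_ac)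
  qed (use aint anonneg \<open>0 \<le> t\<close> in auto)

  \<comment> \<open>Growth of the exponent and return to the unweighted norm\<close>
  also have "\<dots> \<le> D * exp (M * L * t + (\<gamma> + \<omega>' * t))"
  proof -
    have "E t = M * L * t + b * integral {0..t} (\<lambda>s. \<bar>k s\<bar>)"
      unfolding E_def a_def using \<open>0 \<le> t\<close> \<tau>bar
      by (subst Henstock_Kurzweil_Integration.integral_add)
        (auto intro!: integrable_on_mult_right kint)
    also have "\<dots> \<le> M * L * t + (\<gamma> + \<omega>' * t)"
      using assms(18)[OF \<open>0 \<le> t\<close>] by (simp add: b_def)
    finally show ?thesis
      using M \<open>b \<ge> 0\<close> \<open>C \<ge> 0\<close> \<open>K > 0\<close> by (intro mult_left_mono) (auto simp: D_def)
  qed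
  \<comment> \<open>Removing the weight subtracts \<open>\<omega> * t\<close> from the exponent,
    which leaves \<open>\<gamma>\<close> and the claimed rate.\<close>
  finally have "exp (- \<omega> * t) * v t \<le> exp (- \<omega> * t) * (D * exp (M * L * t + (\<gamma> + \<omega>' * t)))"
    by (intro mult_left_mono) auto
  also have "\<dots> = D * exp (- \<omega> * t + (M * L * t + (\<gamma> + \<omega>' * t)))"
    by (simp only: exp_add mult_ac)
  also have "- \<omega> * t + (M * L * t + (\<gamma> + \<omega>' * t)) = \<gamma> + - (\<omega> - \<omega>' - M * L) * t"
    by (simp add: algebra_simps)
  also have "exp (\<gamma> + - (\<omega> - \<omega>' - M * L) * t) = exp \<gamma> * exp (- (\<omega> - \<omega>' - M * L) * t)"
    by (rule exp_add)
  also have "D = M * (norm (f 0) + exp (\<omega> * \<tau>bar) * K * norm B * C)"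
    by (simp add: D_def b_def algebra_simps)
  finally show "norm (U t) \<le> M * exp \<gamma> * (norm (f 0) + exp (\<omega> * \<tau>bar) * K * norm B *
      (SUP s\<in>{-\<tau>bar..0}. norm (exp (\<omega> * s) *\<^sub>R f s))) * exp (- (\<omega> - \<omega>' - M * L) * t)"
    by (simp add: v_def C_def mult_ac exp_minus)
qed

end
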